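(* Let $G\subset[0,1]^n$ be a compact set of positive Lebesgue measure with empty interior and let $b=\{b_m\}_{m\in\mathbb{N}}\subset(0,1)$ satisfy $\lim_{m\to\infty}b_m=0$. Let $G_m:=(2m,0,\dots,0)+G$ for $m\in\mathbb{N}$, and define the weight $w_{G,b}$ on $\mathbb{R}^n$ as follows: for $y=(y_1,\dots,y_n)$ with $y_1\ge0$, $w_{G,b}(y)=b_m$ if $y\in G_m$ for some $m\in\mathbb{N}$ and $w_{G,b}(y)=1$ if $y\notin\bigcup_mG_m$; for $y_1<0$, $w_{G,b}(y):=w_{G,b}(-y)$. Then the reflection-invariant space $L^1(\mathbb{R}^n,w_{G,b}^{-1})$ does not satisfy the norm fundamental property, and there exists $a\in S(\mathbb{R}^n)$ such that $a\in\mathcal{M}_{L^\infty(\mathbb{R}^n,w_{G,b})}\setminus\mathcal{M}_{L^1(\mathbb{R}^n,w_{G,b}^{-1})}$.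
   Context: For a weight $v$ and $1\le p\le\infty$, $L^p(\mathbb{R}^n,v)$ is the space of measurable $f$ with $\|f\|_{L^p(\mathbb{R}^n,v)}:=\|fv\|_{L^p(\mathbb{R}^n)}<\infty$. For a Banach function space $X$ on $\mathbb{R}^n$ with associate space $X'$ (for $X=L^1(\mathbb{R}^n,w^{-1})$ one has $X'=L^\infty(\mathbb{R}^n,w)$), $X$ has the norm fundamental property if for every $f\in X$, $\|f\|_X=\sup\{|\int f\psi\,dx|: \psi\in C_0^\infty(\mathbb{R}^n),\ \|\psi\|_{X'}\le1\}$. Reflection-invariant means $\|f\|_X=\|f(-\cdot)\|_X$ for all $f\in X$. Fourier transform: $(Fu)(\xi)=\int u(x)e^{-ix\xi}dx$, extended to $S'(\mathbb{R}^n)$. For a normed function space $Z$, $\mathcal{M}_{Z}$ is the set of $a\in S'(\mathbb{R}^n)$ with $\sup\{\|F^{-1}aFu\|_{Z}/\|u\|_{Z}: u\in (S(\mathbb{R}^n)\cap Z)\setminus\{0\}\}<\infty$. *)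

theory Defs
  imports "HOL-Analysis.Analysis"
begin

fun iter_deriv :: "'a::euclidean_space list \<Rightarrow> ('a \<Rightarrow> complex) \<Rightarrow> 'a \<Rightarrow> complex" where
  "iter_deriv [] f = f"
| "iter_deriv (v # vs) f = (\<lambda>x. frechet_derivative (iter_deriv vs f) (at x) v)"

definition smooth_fun :: "('a::euclidean_space \<Rightarrow> complex) \<Rightarrow> bool" where
  "smooth_fun f \<longleftrightarrow> (\<forall>vs. set vs \<subseteq> Basis \<longrightarrow> (\<forall>x. iter_deriv vs f differentiable (at x)))"

definition schwartz :: "('a::euclidean_space \<Rightarrow> complex) \<Rightarrow> bool" where
  "schwartz f \<longleftrightarrow> smooth_fun f \<and>
     (\<forall>vs k. set vs \<subseteq> Basis \<longrightarrow>
        bounded (range (\<lambda>x. (1 + norm x) ^ k * norm (iter_deriv vs f x))))"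

definition test_fun :: "('a::euclidean_space \<Rightarrow> complex) \<Rightarrow> bool" where
  "test_fun f \<longleftrightarrow> smooth_fun f \<and> compact (closure {x. f x \<noteq> 0})"

definition fourier :: "('a::euclidean_space \<Rightarrow> complex) \<Rightarrow> 'a \<Rightarrow> complex" where
  "fourier u \<xi> = integral\<^sup>L lborel (\<lambda>x. u x * cis (- (x \<bullet> \<xi>)))"

definition inv_fourier :: "('a::euclidean_space \<Rightarrow> complex) \<Rightarrow> 'a \<Rightarrow> complex" where
  "inv_fourier v x = complex_of_real (1 / (2 * pi) ^ DIM('a)) *
     integral\<^sup>L lborel (\<lambda>\<xi>. v \<xi> * cis (x \<bullet> \<xi>))"

definition L1_inv_norm :: "('a::euclidean_space \<Rightarrow> real) \<Rightarrow> ('a \<Rightarrow> complex) \<Rightarrow> ennreal" where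
  "L1_inv_norm w f = (\<integral>\<^sup>+ x. ennreal (norm (f x) * inverse (w x)) \<partial>lborel)"

definition Linf_norm :: "('a::euclidean_space \<Rightarrow> real) \<Rightarrow> ('a \<Rightarrow> complex) \<Rightarrow> ennreal" where
  "Linf_norm w f = Inf {C. AE x in lborel. ennreal (norm (f x) * w x) \<le> C}"

definition in_space :: "(('a::euclidean_space \<Rightarrow> complex) \<Rightarrow> ennreal) \<Rightarrow> ('a \<Rightarrow> complex) \<Rightarrow> bool" where
  "in_space N f \<longleftrightarrow> f \<in> borel_measurable lborel \<and> N f < \<infinity>"

definition multiplier :: "(('a::euclidean_space \<Rightarrow> complex) \<Rightarrow> ennreal) \<Rightarrow> ('a \<Rightarrow> complex) \<Rightarrow> bool" where
  "multiplier N a \<longleftrightarrow> (\<exists>C::real. \<forall>u. schwartz u \<and> in_space N u \<and> u \<noteq> (\<lambda>_. 0) \<longrightarrow>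
      N (inv_fourier (\<lambda>\<xi>. a \<xi> * fourier u \<xi>)) \<le> ennreal C * N u)"

text \<open>Norm fundamental property of X = L^1(w^{-1}), with X' = L^infinity(w).\<close>
definition L1_inv_norm_fundamental :: "('a::euclidean_space \<Rightarrow> real) \<Rightarrow> bool" where
  "L1_inv_norm_fundamental w \<longleftrightarrow>
     (\<forall>f. in_space (L1_inv_norm w) f \<longrightarrow>
        L1_inv_norm w f = Sup {ennreal (norm (integral\<^sup>L lborel (\<lambda>x. f x * \<psi> x))) | \<psi>.
                                 test_fun \<psi> \<and> Linf_norm w \<psi> \<le> 1})"

text \<open>The weight w_{G,b}; e is the first coordinate direction, m ranges over N = {1,2,...}.\<close>
definition w_half :: "'a::euclidean_space \<Rightarrow> 'a set \<Rightarrow> (nat \<Rightarrow> real) \<Rightarrow> 'a \<Rightarrow> real" where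
  "w_half e G b y = (if \<exists>m\<ge>1. y \<in> (\<lambda>g. (2 * real m) *\<^sub>R e + g) ` G
      then b (THE m. m \<ge> 1 \<and> y \<in> (\<lambda>g. (2 * real m) *\<^sub>R e + g) ` G) else 1)"

definition weightGb :: "'a::euclidean_space \<Rightarrow> 'a set \<Rightarrow> (nat \<Rightarrow> real) \<Rightarrow> 'a \<Rightarrow> real" where
  "weightGb e G b y = (if y \<bullet> e \<ge> 0 then w_half e G b y else w_half e G b (- y))"

end

(* The set where w = 1 contains a dense open set, so for continuous u the L^oo(w)-norm is the plain
   supremum norm. Hence test functions only see the unweighted L^1-norm of the indicator of a spike
   G_m, which rules out the norm fundamental property, and convolution with any integrable kernel is
   bounded in the L^oo(w)-norm of continuous functions. For a(xi) = exp(-|xi|^2/2) the kernel is a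
   positive Gaussian, and it moves a fixed share of the mass of a bump located beside G_m into G_m,
   where the weight 1/b_m of the L^1-norm is unbounded in m. *)
theory Submission
  imports Defs "HOL-Probability.Probability"
begin

text \<open>Both assertions have one cause: the usual duality argument that carries a multiplier
  bound from L^oo(w) to L^1(1/w) tests against smooth functions, and these do not see the spikes.
  Positive measure of \<open>G\<close> lets the L^1-norm feel the factor 1/b_m, while empty interior
  hides that factor from continuous functions. Empty interior of each single spike would not by
  itself control their union. The slabs containing the spikes are separated by gaps of width one, so
  near any point only one closed set with empty interior matters. The same gaps hold the bumps: each
  lies outside all spikes, so that its own norm carries no factor 1/b, yet at a distance from its
  spike that is bounded independently of m, so that one positive lower bound of the kernel serves
  all m. The Gaussian is convenient as a symbol because it is Schwartz and its kernel is explicit: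
  Fubini and the characteristic function of the normal law give (2 pi)^(-n/2) exp(-|x|^2/2).
  Membership in the Schwartz class refers to arbitrary lists of directional derivatives, hence the
  function classes closed under differentiation.\<close>

section \<open>Gaussians and bumps are Schwartz functions\<close>

text \<open>Induction on the list of directions. This reduces control of all iterated derivatives to
  finding one suitable class \<open>F\<close>; later \<open>F\<close> is a
  \<open>poly_span\<close>.\<close>

lemma smooth_fun_if_closed_under_derivatives:
  fixes F :: "('a::euclidean_space \<Rightarrow> complex) set"
  assumes diff: "\<And>f x. f \<in> F \<Longrightarrow> f differentiable (at x)"
    and deriv: "\<And>f v. f \<in> F \<Longrightarrow> v \<in> Basis \<Longrightarrow> (\<lambda>x. frechet_derivative f (at x) v) \<in> F"
    and "f \<in> F"
  shows "smooth_fun f" and "set vs \<subseteq> Basis \<Longrightarrow> iter_deriv vs f \<in> F"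
proof -
  have *: "iter_deriv vs f \<in> F" if "set vs \<subseteq> Basis" for vs
    using that by (induction vs) (auto intro: deriv \<open>f \<in> F\<close>)
  then show "set vs \<subseteq> Basis \<Longrightarrow> iter_deriv vs f \<in> F"
    by blast
  show "smooth_fun f"
    unfolding smooth_fun_def using * diff by blast
qed

text \<open>The direction \<open>v\<close> is kept as a parameter: for each fixed \<open>v\<close>
  the directional derivative is again a polynomial in the base point, which is what closure of
  \<open>poly_span\<close> requires.\<close>

lemma real_polynomial_function_has_derivative:
  assumes "real_polynomial_function (p :: 'a::real_normed_vector \<Rightarrow> real)"
  shows "\<exists>D. (\<forall>x. (p has_derivative D x) (at x)) \<and> (\<forall>v. real_polynomial_function (\<lambda>x. D x v))"
  using assms
proof (induction p rule: real_polynomial_function.induct)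
  case (linear f)
  then show ?case
    by (intro exI[of _ "\<lambda>_. f"]) (auto intro: bounded_linear_imp_has_derivative)
next
  case (const c)
  then show ?case
    by (intro exI[of _ "\<lambda>_ _. 0"]) auto
next
  case (add f g)
  then obtain D E where "\<And>x. (f has_derivative D x) (at x)" "\<And>v. real_polynomial_function (\<lambda>x. D x v)"
    "\<And>x. (g has_derivative E x) (at x)" "\<And>v. real_polynomial_function (\<lambda>x. E x v)"
    by metis
  then show ?case
    by (intro exI[of _ "\<lambda>x v. D x v + E x v"]) (auto intro: has_derivative_add)
next
  case (mult f g)
  then obtain D E where "\<And>x. (f has_derivative D x) (at x)" "\<And>v. real_polynomial_function (\<lambda>x. D x v)"
    "\<And>x. (g has_derivative E x) (at x)" "\<And>v. real_polynomial_function (\<lambda>x. E x v)"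
    by metis
  then show ?case
    by (intro exI[of _ "\<lambda>x v. f x * E x v + D x v * g x"])
       (auto intro!: has_derivative_mult mult.hyps real_polynomial_function.intros(3,4))
qed

lemma real_polynomial_function_norm_squared:
  "real_polynomial_function (\<lambda>x::'a::euclidean_space. (norm (x - c))\<^sup>2)"
proof -
  have "(\<lambda>x::'a. (norm (x - c))\<^sup>2) = (\<lambda>x. \<Sum>i\<in>Basis. (x \<bullet> i + - (c \<bullet> i)) * (x \<bullet> i + - (c \<bullet> i)))"
    unfolding power2_norm_eq_inner by (subst euclidean_inner) (simp add: inner_diff_left)
  moreover have "real_polynomial_function \<dots>"
    by (intro real_polynomial_function_sum real_polynomial_function.intros bounded_linear_inner_left) auto
  ultimately show ?thesis by simp
qed

lemma real_polynomial_function_bound: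
  assumes "real_polynomial_function (p :: 'a::real_normed_vector \<Rightarrow> real)"
  shows "\<exists>C d. C \<ge> 0 \<and> (\<forall>x. \<bar>p x\<bar> \<le> C * (1 + norm x) ^ d)"
  using assms
proof (induction p rule: real_polynomial_function.induct)
  case (linear f)
  then obtain K where "K > 0" "\<And>x. norm (f x) \<le> norm x * K"
    using bounded_linear.pos_bounded by blast
  then have "\<bar>f x\<bar> \<le> K * (1 + norm x) ^ 1" for x
    by (smt (verit) mult.commute mult_left_mono power_one_right real_norm_def)
  with \<open>K > 0\<close> show ?case
    by (intro exI[of _ K] exI[of _ 1]) auto
next
  case (const c)
  then show ?case
    by (intro exI[of _ "\<bar>c\<bar>"] exI[of _ 0]) auto
next
  case (add f g)
  then obtain C d D e where *: "C \<ge> 0" "D \<ge> 0" "\<And>x. \<bar>f x\<bar> \<le> C * (1 + norm x) ^ d" "\<And>x. \<bar>g x\<bar> \<le> D * (1 + norm x) ^ e"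
    by metis
  have "\<bar>f x + g x\<bar> \<le> (C + D) * (1 + norm x) ^ (d + e)" for x
  proof -
    have "\<bar>f x + g x\<bar> \<le> C * (1 + norm x) ^ d + D * (1 + norm x) ^ e"
      using *(3)[of x] *(4)[of x] by linarith
    also have "\<dots> \<le> C * (1 + norm x) ^ (d + e) + D * (1 + norm x) ^ (d + e)"
      using * by (intro add_mono mult_left_mono power_increasing) auto
    finally show ?thesis by (simp add: algebra_simps)
  qed
  then show ?case
    using * by (intro exI[of _ "C + D"] exI[of _ "d + e"]) auto
next
  case (mult f g)
  then obtain C d D e where *: "C \<ge> 0" "D \<ge> 0" "\<And>x. \<bar>f x\<bar> \<le> C * (1 + norm x) ^ d" "\<And>x. \<bar>g x\<bar> \<le> D * (1 + norm x) ^ e"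
    by metis
  have "\<bar>f x * g x\<bar> \<le> (C * D) * (1 + norm x) ^ (d + e)" for x
  proof -
    have "\<bar>f x * g x\<bar> \<le> (C * (1 + norm x) ^ d) * (D * (1 + norm x) ^ e)"
      unfolding abs_mult using * by (intro mult_mono) auto
    then show ?thesis by (simp add: power_add mult_ac)
  qed
  then show ?case
    using * by (intro exI[of _ "C * D"] exI[of _ "d + e"]) auto
qed

text \<open>For a class \<open>H\<close> of functions closed under derivatives, the finite sums of terms
  \<open>p \<sqdot> (h \<circ> q)\<close> with \<open>h \<in> H\<close> and polynomials \<open>p\<close> are closed under directional derivatives;
  this covers both Gaussians and bump functions.\<close>

inductive_set poly_span :: "(real \<Rightarrow> real) set \<Rightarrow> ('a::euclidean_space \<Rightarrow> real) \<Rightarrow> ('a \<Rightarrow> complex) set"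
  for H q where
  base: "real_polynomial_function p \<Longrightarrow> h \<in> H \<Longrightarrow> (\<lambda>x. complex_of_real (p x * h (q x))) \<in> poly_span H q"
| add: "f \<in> poly_span H q \<Longrightarrow> g \<in> poly_span H q \<Longrightarrow> (\<lambda>x. f x + g x) \<in> poly_span H q"

text \<open>The product and chain rules turn one term p h(q) into the two terms (p Dq) h'(q) and
  (Dp) h(q); this is why the class has to admit sums.\<close>

lemma poly_span_has_derivative:
  assumes H: "\<And>h. h \<in> H \<Longrightarrow> \<exists>h'\<in>H. \<forall>t. (h has_real_derivative h' t) (at t)"
    and q: "real_polynomial_function q"
    and "f \<in> poly_span H q"
  shows "\<exists>D. (\<forall>x. (f has_derivative D x) (at x)) \<and> (\<forall>v. (\<lambda>x. D x v) \<in> poly_span H q)"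
  using \<open>f \<in> poly_span H q\<close>
proof (induction f rule: poly_span.induct)
  case (base p h)
  obtain P where P: "\<And>x. (p has_derivative P x) (at x)" "\<And>v. real_polynomial_function (\<lambda>x. P x v)"
    using real_polynomial_function_has_derivative[OF base(1)] by blast
  obtain Q where Q: "\<And>x. (q has_derivative Q x) (at x)" "\<And>v. real_polynomial_function (\<lambda>x. Q x v)"
    using real_polynomial_function_has_derivative[OF q] by blast
  obtain h' where h': "h' \<in> H" "\<And>t. (h has_real_derivative h' t) (at t)"
    using H[OF base(2)] by blast
  let ?D = "\<lambda>x v. complex_of_real (p x * Q x v * h' (q x)) + complex_of_real (P x v * h (q x))"
  have "((\<lambda>x. complex_of_real (p x * h (q x))) has_derivative ?D x) (at x)" for x
  proof -
    have "((\<lambda>x. h (q x)) has_derivative (\<lambda>v. h' (q x) * Q x v)) (at x)"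
      using h'(2)[of "q x"] Q(1)[of x] unfolding has_field_derivative_def
      by (rule has_derivative_compose[rotated])
    then have "((\<lambda>x. p x * h (q x)) has_derivative (\<lambda>v. p x * (h' (q x) * Q x v) + P x v * h (q x))) (at x)"
      by (intro has_derivative_mult P)
    from has_derivative_of_real[OF this] show ?thesis
      by (simp add: mult_ac)
  qed
  moreover have "(\<lambda>x. ?D x v) \<in> poly_span H q" for v
    by (intro poly_span.intros real_polynomial_function.intros base h' P Q)
  ultimately show ?case
    by (intro exI[of _ ?D]) auto
next
  case (add f g)
  then obtain D E where "\<And>x. (f has_derivative D x) (at x)" "\<And>v. (\<lambda>x. D x v) \<in> poly_span H q"
    "\<And>x. (g has_derivative E x) (at x)" "\<And>v. (\<lambda>x. E x v) \<in> poly_span H q"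
    by metis
  then show ?case
    by (intro exI[of _ "\<lambda>x v. D x v + E x v"]) (auto intro: has_derivative_add poly_span.intros)
qed

text \<open>The factor (1 + |x|)^k is not a polynomial, but it is at most 2^k (1 + |x|^2)^k, and
  this polynomial can be absorbed into \<open>p\<close>. So boundedness of all products in
  \<open>decay\<close> already yields every Schwartz seminorm.\<close>

lemma schwartz_poly_span:
  assumes H: "\<And>h. h \<in> H \<Longrightarrow> \<exists>h'\<in>H. \<forall>t. (h has_real_derivative h' t) (at t)"
    and q: "real_polynomial_function q"
    and decay: "\<And>p h. real_polynomial_function p \<Longrightarrow> h \<in> H \<Longrightarrow> bounded (range (\<lambda>x. p x * h (q x)))"
    and f: "f \<in> poly_span H (q :: 'a::euclidean_space \<Rightarrow> real)"
  shows "schwartz f"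
proof -
  have diff: "f differentiable (at x)" if "f \<in> poly_span H q" for f x
    using poly_span_has_derivative[OF H q that] differentiable_def by blast
  have deriv: "(\<lambda>x. frechet_derivative f (at x) v) \<in> poly_span H q" if f: "f \<in> poly_span H q" for f v
  proof -
    obtain D where D: "\<And>x. (f has_derivative D x) (at x)" "\<And>v. (\<lambda>x. D x v) \<in> poly_span H q"
      using poly_span_has_derivative[OF H q f] by blast
    \<comment> \<open>\<open>frechet_derivative\<close> is defined by choice; uniqueness of the
      derivative identifies it with \<open>D\<close>.\<close>
    then have "frechet_derivative f (at x) = D x" for x
      by (metis frechet_derivative_at)
    then show ?thesis using D by simp
  qed
  have bnd: "bounded (range (\<lambda>x. (1 + norm x) ^ k * norm (g x)))" if "g \<in> poly_span H q" for g k
    using that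
  proof (induction g rule: poly_span.induct)
    case (base p h)
    let ?r = "\<lambda>x. (1 + (norm (x - 0))\<^sup>2) ^ k * p x :: real"
    have pow: "real_polynomial_function (\<lambda>x::'a. (1 + (norm (x - 0))\<^sup>2) ^ k)"
      by (intro real_polynomial_function_power real_polynomial_function.intros(3) real_polynomial_function.intros(2)
            real_polynomial_function_norm_squared)
    have "real_polynomial_function ?r"
      by (rule real_polynomial_function.intros(4)[OF pow base(1)])
    from decay[OF this base(2)] obtain B where B: "\<And>x. norm (?r x * h (q x)) \<le> B"
      unfolding bounded_iff by blast
    have "norm ((1 + norm x) ^ k * norm (complex_of_real (p x * h (q x)))) \<le> 2 ^ k * B" for x
    proof -
      have "2 * norm x \<le> 1 + (norm x)\<^sup>2"
        using sum_squares_bound[of 1 "norm x"] by simp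
      then have "1 + norm x \<le> 2 * (1 + (norm x)\<^sup>2)"
        using zero_le_power2[of "norm x"] by (smt (verit))
      then have "(1 + norm x) ^ k \<le> (2 * (1 + (norm x)\<^sup>2)) ^ k"
        by (intro power_mono) auto
      then have "(1 + norm x) ^ k * \<bar>p x * h (q x)\<bar> \<le> (2 * (1 + (norm x)\<^sup>2)) ^ k * \<bar>p x * h (q x)\<bar>"
        by (intro mult_right_mono) auto
      also have "\<dots> = 2 ^ k * norm (?r x * h (q x))"
        unfolding power_mult_distrib[of 2] by (simp add: abs_mult)
      also have "\<dots> \<le> 2 ^ k * B"
        using B by (intro mult_left_mono) auto
      finally show ?thesis by (simp add: abs_mult norm_mult)
    qed
    then show ?case unfolding bounded_iff by blast
  next
    case (add f g)
    then obtain B C where BC: "\<And>x. norm ((1 + norm x) ^ k * norm (f x)) \<le> B" "\<And>x. norm ((1 + norm x) ^ k * norm (g x)) \<le> C"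
      unfolding bounded_iff by blast
    have "norm ((1 + norm x) ^ k * norm (f x + g x)) \<le> B + C" for x
    proof -
      have "(1 + norm x) ^ k * norm (f x + g x) \<le> (1 + norm x) ^ k * (norm (f x) + norm (g x))"
        by (intro mult_left_mono norm_triangle_ineq) auto
      then show ?thesis using BC[of x] by (simp add: algebra_simps)
    qed
    then show ?case unfolding bounded_iff by blast
  qed
  note closed = smooth_fun_if_closed_under_derivatives[where F = "poly_span H q", OF diff deriv f]
  show ?thesis
    unfolding schwartz_def using closed bnd by blast
qed

text \<open>A single term of the exponential series is at most the whole sum.\<close>

lemma power_le_fact_times_exp:
  assumes "(x::real) \<ge> 0" shows "x ^ n \<le> fact n * exp x"
proof -
  have "(\<Sum>k\<in>{n}. x ^ k /\<^sub>R fact k) \<le> exp x"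
    unfolding exp_def using assms by (intro sum_le_suminf summable_exp_generic) auto
  then show ?thesis by (simp add: field_simps)
qed

lemma schwartz_gaussian: "schwartz (\<lambda>x::'a::euclidean_space. complex_of_real (exp (- (norm x)\<^sup>2 / 2)))"
proof -
  define q where "q = (\<lambda>x::'a. (-1/2) * (norm (x - 0))\<^sup>2)"
  have q: "real_polynomial_function q"
    unfolding q_def by (intro real_polynomial_function.intros real_polynomial_function_norm_squared)
  have "bounded (range (\<lambda>x. p x * exp (q x)))" if p: "real_polynomial_function p" for p
  proof -
    obtain C d where C: "C \<ge> 0" "\<And>x. \<bar>p x\<bar> \<le> C * (1 + norm x) ^ d"
      using real_polynomial_function_bound[OF p] by blast
    have "norm (p x * exp (q x)) \<le> C * (fact d * exp (3/2))" for x
    proof -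
      have "(1 + norm x) ^ d \<le> fact d * exp (1 + norm x)"
        by (rule power_le_fact_times_exp) simp
      then have "norm (p x * exp (q x)) \<le> C * (fact d * exp (1 + norm x)) * exp (q x)"
        using C(1) C(2)[of x] unfolding norm_mult
        by (intro mult_mono) (auto intro: order_trans mult_left_mono)
      also have "\<dots> = C * (fact d * exp (1 + norm x + q x))"
        by (simp add: exp_add)
      \<comment> \<open>With t = |x| this is 1 + t - t^2/2, which 2 t <= 1 + t^2 bounds by its value
        at t = 1.\<close>
      also have "1 + norm x + q x \<le> 3/2"
        using sum_squares_bound[of 1 "norm x"] by (simp add: q_def)
      finally show ?thesis using C(1) by (simp add: mult_left_mono)
    qed
    then show ?thesis unfolding bounded_iff by blast
  qed
  moreover have "(exp has_real_derivative exp t) (at t)" for t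
    by (rule DERIV_exp)
  moreover have "(\<lambda>x. complex_of_real (1 * exp (q x))) \<in> poly_span {exp} q"
    by (intro poly_span.intros real_polynomial_function.intros) auto
  ultimately have "schwartz (\<lambda>x. complex_of_real (1 * exp (q x)))"
    using q by (intro schwartz_poly_span[of "{exp}" q]) auto
  then show ?thesis by (simp add: q_def)
qed

text \<open>The classical smooth function exp(-1/t), continued by 0. The polynomial factor in 1/t is
  carried along so that the family contains its own derivatives.\<close>

definition flat_fun :: "real poly \<Rightarrow> real \<Rightarrow> real" where
  "flat_fun p t = (if t > 0 then poly p (1 / t) * exp (- (1 / t)) else 0)"

lemma tendsto_poly_times_exp_minus: "((\<lambda>s. poly p s * exp (- s)) \<longlongrightarrow> (0::real)) at_top"
proof -
  have "((\<lambda>s. \<Sum>i\<le>degree p. coeff p i * (s ^ i / exp s)) \<longlongrightarrow> (\<Sum>i\<le>degree p. coeff p i * 0)) at_top"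
    by (intro tendsto_intros tendsto_power_div_exp_0)
  then show ?thesis
    by (simp add: poly_altdef sum_distrib_left exp_minus divide_inverse mult_ac)
qed

text \<open>With s = 1/t one has ds/dt = -s^2, so p(s) exp(-s) has derivative s^2 (p(s) - p'(s))
  exp(-s); \<open>[:0, 0, 1:]\<close> is the factor s^2. At 0 both one-sided difference quotients
  tend to 0.\<close>

lemma flat_fun_has_derivative:
  "(flat_fun p has_real_derivative flat_fun ([:0, 0, 1:] * (p - pderiv p)) t) (at t)"
proof -
  consider "t > 0" | "t < 0" | "t = 0" by linarith
  then show ?thesis
  proof cases
    case 1
    have "((\<lambda>t. poly p (1 / t) * exp (- (1 / t))) has_real_derivative
        flat_fun ([:0, 0, 1:] * (p - pderiv p)) t) (at t)"
      using 1 by (auto intro!: derivative_eq_intros DERIV_chain'[OF _ poly_DERIV]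
          simp: flat_fun_def field_simps power2_eq_square)
    moreover have "\<forall>\<^sub>F y in nhds t. flat_fun p y = poly p (1 / y) * exp (- (1 / y))"
      using eventually_nhds_in_open[of "{0<..}" t] 1 by (auto simp: flat_fun_def elim: eventually_mono)
    ultimately show ?thesis
      by (simp add: DERIV_cong_ev)
  next
    case 2
    have "\<forall>\<^sub>F y in nhds t. flat_fun p y = 0"
      using eventually_nhds_in_open[of "{..<0}" t] 2 by (auto simp: flat_fun_def elim: eventually_mono)
    then have "(flat_fun p has_real_derivative 0) (at t)"
      by (subst DERIV_cong_ev[where g = "\<lambda>_. 0"]) auto
    then show ?thesis using 2 by (simp add: flat_fun_def)
  next
    case 3
    \<comment> \<open>Dividing by h multiplies by s = 1/h, and \<open>pCons 0 p\<close> is the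
      polynomial s p(s).\<close>
    have "((\<lambda>h. poly (pCons 0 p) (inverse h) * exp (- inverse h)) \<longlongrightarrow> 0) (at_right 0)"
      by (rule filterlim_compose[OF tendsto_poly_times_exp_minus filterlim_inverse_at_top_right])
    moreover have "\<forall>\<^sub>F h in at_right 0. poly (pCons 0 p) (inverse h) * exp (- inverse h) = flat_fun p h / h"
      using eventually_at_right_less[of "0::real"] by eventually_elim (auto simp: flat_fun_def field_simps)
    ultimately have "((\<lambda>h. flat_fun p h / h) \<longlongrightarrow> 0) (at_right 0)"
      by (blast intro: Lim_transform_eventually)
    moreover have "((\<lambda>h. flat_fun p h / h) \<longlongrightarrow> 0) (at_left 0)"
      by (rule tendsto_eventually) (auto simp: flat_fun_def eventually_at_filter)
    ultimately have "((\<lambda>h. flat_fun p h / h) \<longlongrightarrow> 0) (at 0)"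
      by (rule filterlim_split_at_real[rotated])
    then show ?thesis using 3 by (simp add: DERIV_def flat_fun_def)
  qed
qed

text \<open>The inner polynomial is positive exactly on the open ball of radius |r| about
  \<open>c\<close>. Hence the products in \<open>decay\<close> are continuous and vanish off a
  compact ball, which bounds them.\<close>

lemma schwartz_bump:
  fixes c :: "'a::euclidean_space" and r :: real
  shows "schwartz (\<lambda>x. complex_of_real (flat_fun 1 (r\<^sup>2 - (norm (x - c))\<^sup>2)))"
proof -
  define q where "q = (\<lambda>x. r\<^sup>2 - (norm (x - c))\<^sup>2)"
  have q: "real_polynomial_function q"
    unfolding q_def by (intro real_polynomial_function_diff real_polynomial_function.intros(2)
        real_polynomial_function_norm_squared)
  have decay: "bounded (range (\<lambda>x. p x * h (q x)))"
    if p: "real_polynomial_function p" and h: "h \<in> range flat_fun" for p h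
  proof -
    obtain s where s: "h = flat_fun s" using h by blast
    have "continuous_on UNIV (flat_fun s)"
      by (intro continuous_at_imp_continuous_on ballI DERIV_isCont[OF flat_fun_has_derivative])
    then have "continuous_on (cball c \<bar>r\<bar>) (\<lambda>x. flat_fun s (q x))"
      using continuous_on_polymonial_function[OF q[unfolded real_polynomial_function_eq]] by (rule continuous_on_compose2) auto
    then have "continuous_on (cball c \<bar>r\<bar>) (\<lambda>x. p x * flat_fun s (q x))"
      using continuous_on_polymonial_function[OF p[unfolded real_polynomial_function_eq]] by (intro continuous_on_mult) auto
    then have "bounded ((\<lambda>x. p x * flat_fun s (q x)) ` cball c \<bar>r\<bar>)"
      by (intro compact_imp_bounded compact_continuous_image) auto
    moreover have "p x * flat_fun s (q x) = 0" if "x \<notin> cball c \<bar>r\<bar>" for x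
    proof -
      have "\<bar>r\<bar> \<le> norm (x - c)" using that by (simp add: dist_norm norm_minus_commute)
      then have "q x \<le> 0"
        using power_mono[of "\<bar>r\<bar>" "norm (x - c)" 2] by (simp add: q_def)
      then show ?thesis by (simp add: flat_fun_def)
    qed
    then have "range (\<lambda>x. p x * flat_fun s (q x)) \<subseteq> insert 0 ((\<lambda>x. p x * flat_fun s (q x)) ` cball c \<bar>r\<bar>)"
      by (metis (no_types, lifting) image_eqI image_subsetI insertCI)
    ultimately show ?thesis
      unfolding s by (rule bounded_subset[OF bounded_insert[THEN iffD2]])
  qed
  have deriv: "\<exists>h'\<in>range flat_fun. \<forall>t. (h has_real_derivative h' t) (at t)" if h: "h \<in> range flat_fun" for h
  proof -
    obtain s where "h = flat_fun s" using h by blast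
    then show ?thesis
      by (intro bexI[of _ "flat_fun ([:0, 0, 1:] * (s - pderiv s))"]) (simp_all only: flat_fun_has_derivative rangeI simp_thms)
  qed
  have "(\<lambda>x. complex_of_real (1 * flat_fun 1 (q x))) \<in> poly_span (range flat_fun) q"
    by (intro poly_span.intros real_polynomial_function.intros) auto
  then have "schwartz (\<lambda>x. complex_of_real (1 * flat_fun 1 (q x)))"
    by (rule schwartz_poly_span[where H = "range flat_fun" and q = q, OF deriv q decay, rotated -1])
  then show ?thesis by (simp add: q_def)
qed

lemma smooth_fun_continuous_on:
  assumes "smooth_fun u" shows "continuous_on UNIV u"
proof -
  have "\<forall>x. iter_deriv [] u differentiable (at x)"
    using assms unfolding smooth_fun_def by (metis empty_set empty_subsetI)
  then show ?thesis
    by (auto intro!: continuous_at_imp_continuous_on differentiable_imp_continuous_within)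
qed

section \<open>Integrals over coordinates and convolution with the Gaussian\<close>

text \<open>\<open>lborel\<close> is the image of the product of one-dimensional Lebesgue measures
  under the coordinate map, so the product form of Fubini applies. The value type covers both real
  majorants and complex Fourier integrands.\<close>

lemma
  fixes f :: "'a::euclidean_space \<Rightarrow> real \<Rightarrow> 'b::{real_normed_field, banach, second_countable_topology}"
  assumes int: "\<And>i. i \<in> Basis \<Longrightarrow> integrable lborel (f i)"
  shows integrable_lborel_prod_Basis: "integrable lborel (\<lambda>x::'a. \<Prod>i\<in>Basis. f i (x \<bullet> i))"
    and integral_lborel_prod_Basis:
      "integral\<^sup>L lborel (\<lambda>x::'a. \<Prod>i\<in>Basis. f i (x \<bullet> i)) = (\<Prod>i\<in>Basis. \<integral>t. f i t \<partial>lborel)"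
proof -
  interpret product_sigma_finite "\<lambda>_::'a. lborel :: real measure"
    by standard
  have [measurable]: "f i \<in> borel_measurable borel" if "i \<in> Basis" for i
    using int[OF that] by (simp add: borel_measurable_integrable)
  have meas: "(\<lambda>x::'a. \<Prod>i\<in>Basis. f i (x \<bullet> i)) \<in> borel_measurable borel"
  proof (rule borel_measurable_prod)
    fix i :: 'a assume "i \<in> Basis"
    then have "f i \<in> borel_measurable borel" by measurable
    then show "(\<lambda>x::'a. f i (x \<bullet> i)) \<in> borel_measurable borel"
      by (rule measurable_compose[rotated]) simp
  qed
  have comp: "(\<Prod>i\<in>Basis. f i ((\<Sum>b\<in>Basis. g b *\<^sub>R b) \<bullet> i)) = (\<Prod>i\<in>Basis. f i (g i))" for g
    by (intro prod.cong refl) (simp add: inner_sum_left inner_Basis if_distrib sum.delta cong: if_cong)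
  have [measurable]: "(\<lambda>g. \<Sum>b\<in>Basis. g b *\<^sub>R b :: 'a) \<in> borel_measurable (\<Pi>\<^sub>M b\<in>Basis. lborel)"
    by measurable
  show "integrable lborel (\<lambda>x::'a. \<Prod>i\<in>Basis. f i (x \<bullet> i))"
    using product_integrable_prod[of Basis f] int
    by (subst lborel_eq, subst integrable_distr_eq) (auto simp: meas comp)
  show "integral\<^sup>L lborel (\<lambda>x::'a. \<Prod>i\<in>Basis. f i (x \<bullet> i)) = (\<Prod>i\<in>Basis. \<integral>t. f i t \<partial>lborel)"
    using product_integral_prod[of Basis f] int
    by (subst lborel_eq, subst integral_distr) (auto simp: meas comp)
qed

text \<open>The majorant is a multiple of the product of the 1/(1 + x_i^2). Each factor 1 + x_i^2 is
  at most (1 + |x|)^2, so the seminorm with exponent \<open>2 * DIM('a)\<close> suffices.\<close>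

lemma schwartz_integrable:
  fixes u :: "'a::euclidean_space \<Rightarrow> complex"
  assumes "schwartz u" shows "integrable lborel u"
proof -
  define g where "g = (\<lambda>x::'a. \<Prod>i\<in>Basis. inverse (1 + (x \<bullet> i)\<^sup>2))"
  have "set_integrable lborel (einterval (-\<infinity>) \<infinity>) (\<lambda>x. inverse (1 + x\<^sup>2))"
    by (rule integrable_inverse_1_plus_square)
  then have "integrable lborel (\<lambda>x::real. inverse (1 + x\<^sup>2))"
    by (simp add: set_integrable_def einterval_def)
  then have g: "integrable lborel g"
    unfolding g_def by (rule integrable_lborel_prod_Basis)
  have "bounded (range (\<lambda>x. (1 + norm x) ^ (2 * DIM('a)) * norm (iter_deriv [] u x)))"
    using assms unfolding schwartz_def by (metis empty_set empty_subsetI)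
  then obtain B where B: "\<And>x. (1 + norm x) ^ (2 * DIM('a)) * norm (u x) \<le> B"
    unfolding bounded_iff by (auto simp: abs_mult)
  have "norm (u x) \<le> norm (B * g x)" for x
  proof -
    have "(\<Prod>i\<in>Basis. 1 + (x \<bullet> i)\<^sup>2) \<le> (\<Prod>i\<in>(Basis::'a set). (1 + norm x)\<^sup>2)"
    proof (intro prod_mono conjI)
      fix i :: 'a assume "i \<in> Basis"
      then have "(x \<bullet> i)\<^sup>2 \<le> (norm x)\<^sup>2"
        using Basis_le_norm[of i x] by (simp add: abs_le_square_iff[symmetric])
      then show "1 + (x \<bullet> i)\<^sup>2 \<le> (1 + norm x)\<^sup>2"
        using norm_ge_zero[of x] unfolding power2_sum by (simp add: add_increasing2)
    qed auto
    also have "\<dots> = (1 + norm x) ^ (2 * DIM('a))"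
      by (simp add: power_mult)
    finally have "(\<Prod>i\<in>Basis. 1 + (x \<bullet> i)\<^sup>2) * norm (u x) \<le> B"
      by (meson B mult_right_mono norm_ge_zero order_trans)
    moreover have "g x = inverse (\<Prod>i\<in>Basis. 1 + (x \<bullet> i)\<^sup>2)"
      using prod_inversef[of "\<lambda>i. 1 + (x \<bullet> i)\<^sup>2" Basis] by (simp add: g_def o_def)
    moreover have "(\<Prod>i\<in>Basis. 1 + (x \<bullet> i)\<^sup>2) > 0"
      by (intro prod_pos) (simp add: add_pos_nonneg)
    ultimately have "norm (u x) \<le> B * g x"
      by (simp add: field_simps)
    then show ?thesis by simp
  qed
  then show ?thesis
    using g smooth_fun_continuous_on[of u] assms[unfolded schwartz_def]
    by (intro Bochner_Integration.integrable_bound[of lborel "\<lambda>x. B * g x" u])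
       (auto simp: borel_measurable_continuous_onI)
qed

text \<open>Everything factors over the coordinates; in one dimension the Fourier integral is, up to
  sqrt(2 pi), the characteristic function of the standard normal law.\<close>

lemma integrable_gaussian:
  "integrable lborel (\<lambda>x::'a::euclidean_space. exp (- (norm x)\<^sup>2 / 2))"
  and gaussian_fourier_integral: "(\<integral>\<xi>. complex_of_real (exp (- (norm \<xi>)\<^sup>2 / 2)) * cis (z \<bullet> \<xi>) \<partial>lborel)
     = complex_of_real (sqrt (2 * pi) ^ DIM('a) * exp (- (norm (z::'a))\<^sup>2 / 2))"
proof -
  have normsq: "(norm x)\<^sup>2 = (\<Sum>i\<in>Basis. (x \<bullet> i)\<^sup>2)" for x :: 'a
    unfolding power2_norm_eq_inner by (subst euclidean_inner) (simp add: power2_eq_square)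
  have expprod: "exp (- (norm x)\<^sup>2 / 2) = (\<Prod>i\<in>Basis. exp (- (x \<bullet> i)\<^sup>2 / 2))" for x :: 'a
    by (simp add: normsq exp_sum[symmetric] sum_negf sum_divide_distrib)
  have dens: "exp (- (t\<^sup>2 / 2)) = sqrt (2 * pi) * std_normal_density t" for t
    by (simp add: std_normal_density_def)
  have I: "integrable lborel std_normal_density"
    using integrable_std_normal_moment[of 0] by simp
  then have int1: "integrable lborel (\<lambda>t::real. exp (- t\<^sup>2 / 2))"
    by (simp add: dens)
  have E: "(\<integral>t. complex_of_real (exp (- t\<^sup>2 / 2)) * cis (s * t) \<partial>lborel)
      = complex_of_real (sqrt (2 * pi) * exp (- s\<^sup>2 / 2))" for s
  proof -
    have "complex_of_real (exp (- s\<^sup>2 / 2)) = char std_normal_distribution s"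
      by (simp add: char_std_normal_distribution)
    also have "\<dots> = (\<integral>t. std_normal_density t *\<^sub>R iexp (s * t) \<partial>lborel)"
      unfolding char_def by (subst integral_density) auto
    finally have "complex_of_real (sqrt (2 * pi) * exp (- s\<^sup>2 / 2))
        = complex_of_real (sqrt (2 * pi)) * (\<integral>t. std_normal_density t *\<^sub>R iexp (s * t) \<partial>lborel)"
      by simp
    also have "\<dots> = (\<integral>t. complex_of_real (exp (- t\<^sup>2 / 2)) * cis (s * t) \<partial>lborel)"
      by (subst integral_mult_right_zero[symmetric])
         (simp add: dens cis_conv_exp scaleR_conv_of_real mult_ac)
    finally show ?thesis by simp
  qed
  have int2: "integrable lborel (\<lambda>t. complex_of_real (exp (- t\<^sup>2 / 2)) * cis (s * t))" for s
    by (rule Bochner_Integration.integrable_bound[OF int1])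
       (auto simp: norm_mult cis_conv_exp intro!: borel_measurable_continuous_onI continuous_intros)
  show "integrable lborel (\<lambda>x::'a. exp (- (norm x)\<^sup>2 / 2))"
    unfolding expprod by (rule integrable_lborel_prod_Basis[OF int1])
  have "cis (z \<bullet> x) = (\<Prod>i\<in>Basis. cis ((z \<bullet> i) * (x \<bullet> i)))" for x
    by (simp add: cis_conv_exp euclidean_inner[of z x] exp_sum[symmetric] sum_distrib_left)
  then have "(\<integral>\<xi>. complex_of_real (exp (- (norm \<xi>)\<^sup>2 / 2)) * cis (z \<bullet> \<xi>) \<partial>lborel)
    = (\<integral>\<xi>. (\<Prod>i\<in>Basis. complex_of_real (exp (- (\<xi> \<bullet> i)\<^sup>2 / 2)) * cis ((z \<bullet> i) * (\<xi> \<bullet> i))) \<partial>lborel)"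
    by (simp add: expprod[simplified] prod.distrib)
  also have "\<dots> = (\<Prod>i\<in>Basis. complex_of_real (sqrt (2 * pi) * exp (- (z \<bullet> i)\<^sup>2 / 2)))"
    using integral_lborel_prod_Basis[of "\<lambda>i t. complex_of_real (exp (- t\<^sup>2 / 2)) * cis ((z \<bullet> i) * t)", OF int2]
    by (simp only: E)
  also have "\<dots> = complex_of_real (sqrt (2 * pi) ^ DIM('a) * exp (- (norm z)\<^sup>2 / 2))"
    by (simp add: expprod[simplified] prod.distrib)
  finally show "(\<integral>\<xi>. complex_of_real (exp (- (norm \<xi>)\<^sup>2 / 2)) * cis (z \<bullet> \<xi>) \<partial>lborel)
     = complex_of_real (sqrt (2 * pi) ^ DIM('a) * exp (- (norm z)\<^sup>2 / 2))" .
qed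

text \<open>Inserting the definition of \<open>fourier u\<close> gives a double integral whose
  integrand has modulus exp(-|\<xi>|^2/2) |u(y)|, so Fubini applies; the inner integral over \<xi>
  is the Gaussian Fourier integral at x - y.\<close>

lemma gaussian_multiplier_conv:
  fixes u :: "'a::euclidean_space \<Rightarrow> complex"
  assumes u: "integrable lborel u"
  shows "inv_fourier (\<lambda>\<xi>. complex_of_real (exp (- (norm \<xi>)\<^sup>2 / 2)) * fourier u \<xi>) x =
    complex_of_real (sqrt (2 * pi) ^ DIM('a) / (2 * pi) ^ DIM('a)) *
      (\<integral>y. u y * complex_of_real (exp (- (norm (x - y))\<^sup>2 / 2)) \<partial>lborel)"
proof -
  define F where "F = (\<lambda>\<xi> y. complex_of_real (exp (- (norm \<xi>)\<^sup>2 / 2)) * u y * cis ((x - y) \<bullet> \<xi>))"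
  have [measurable]: "u \<in> borel_measurable borel"
    using u by (simp add: borel_measurable_integrable)
  have [measurable]: "(\<lambda>p::'a \<times> 'a. cis ((x - snd p) \<bullet> fst p)) \<in> borel_measurable (lborel \<Otimes>\<^sub>M lborel)"
    unfolding lborel_prod measurable_lborel1
    by (auto simp: cis_conv_exp intro!: borel_measurable_continuous_onI continuous_intros)
  have F_int: "integrable (lborel \<Otimes>\<^sub>M lborel) (case_prod F)"
  proof (rule lborel_pair.Fubini_integrable)
    show "case_prod F \<in> borel_measurable (lborel \<Otimes>\<^sub>M lborel)"
      unfolding F_def case_prod_beta by measurable
    have "norm (case_prod F (\<xi>, y)) = exp (- (norm \<xi>)\<^sup>2 / 2) * norm (u y)" for \<xi> y
      by (simp add: F_def norm_mult)
    then show "integrable lborel (\<lambda>\<xi>. \<integral>y. norm (case_prod F (\<xi>, y)) \<partial>lborel)"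
      using integrable_gaussian[where 'a = 'a] by simp
    show "AE \<xi> in lborel. integrable lborel (\<lambda>y. case_prod F (\<xi>, y))"
    proof (rule AE_I2)
      fix \<xi> :: 'a
      have "(\<lambda>y. cis ((x - y) \<bullet> \<xi>)) \<in> borel_measurable borel"
        by (auto simp: cis_conv_exp intro!: borel_measurable_continuous_onI continuous_intros)
      then show "integrable lborel (\<lambda>y. case_prod F (\<xi>, y))"
        by (intro Bochner_Integration.integrable_bound[OF u]) (auto simp: F_def norm_mult mult_left_le_one_le)
    qed
  qed
  have "complex_of_real (exp (- (norm \<xi>)\<^sup>2 / 2)) * fourier u \<xi> * cis (x \<bullet> \<xi>) = (\<integral>y. F \<xi> y \<partial>lborel)" for \<xi>
  proof -
    have "F \<xi> y = complex_of_real (exp (- (norm \<xi>)\<^sup>2 / 2)) * cis (x \<bullet> \<xi>) * (u y * cis (- (y \<bullet> \<xi>)))" for y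
      by (simp add: F_def inner_diff_left cis_mult)
    then show ?thesis
      by (simp add: fourier_def)
  qed
  then have "(\<integral>\<xi>. complex_of_real (exp (- (norm \<xi>)\<^sup>2 / 2)) * fourier u \<xi> * cis (x \<bullet> \<xi>) \<partial>lborel)
      = (\<integral>\<xi>. (\<integral>y. F \<xi> y \<partial>lborel) \<partial>lborel)"
    by simp
  also have "\<dots> = (\<integral>y. (\<integral>\<xi>. F \<xi> y \<partial>lborel) \<partial>lborel)"
    using lborel_pair.Fubini_integral[OF F_int] by simp
  finally have iterated: "(\<integral>\<xi>. complex_of_real (exp (- (norm \<xi>)\<^sup>2 / 2)) * fourier u \<xi> * cis (x \<bullet> \<xi>) \<partial>lborel)
      = (\<integral>y. (\<integral>\<xi>. F \<xi> y \<partial>lborel) \<partial>lborel)" .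
  have "(\<integral>\<xi>. F \<xi> y \<partial>lborel) = complex_of_real (sqrt (2 * pi) ^ DIM('a)) *
      (u y * complex_of_real (exp (- (norm (x - y))\<^sup>2 / 2)))" for y
  proof -
    have "(\<integral>\<xi>. F \<xi> y \<partial>lborel) = u y * (\<integral>\<xi>. complex_of_real (exp (- (norm \<xi>)\<^sup>2 / 2)) * cis ((x - y) \<bullet> \<xi>) \<partial>lborel)"
      by (subst integral_mult_right_zero[symmetric]) (simp add: F_def mult_ac)
    then show ?thesis by (simp add: gaussian_fourier_integral[simplified])
  qed
  then have inner: "(\<lambda>y. \<integral>\<xi>. F \<xi> y \<partial>lborel) = (\<lambda>y. complex_of_real (sqrt (2 * pi) ^ DIM('a)) *
      (u y * complex_of_real (exp (- (norm (x - y))\<^sup>2 / 2))))"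
    by (rule ext)
  show ?thesis
    unfolding inv_fourier_def iterated inner integral_mult_right_zero
    by (simp only: mult.assoc[symmetric] of_real_mult[symmetric] times_divide_eq_left mult_1_left)
qed

section \<open>The spikes and the weight\<close>

lemma not_AE_notin_open:
  fixes V :: "'a::euclidean_space set"
  assumes "open V" "V \<noteq> {}" shows "\<not> (AE x in lborel. x \<notin> V)"
proof
  assume "AE x in lborel. x \<notin> V"
  then have "V \<in> null_sets lborel"
    using assms by (subst AE_iff_null_sets) auto
  then have "negligible V"
    using negligible_iff_null_sets null_sets_completionI by blast
  then show False
    using open_not_negligible assms by blast
qed

locale spiked_weight =
  fixes G :: "'a::euclidean_space set" and b :: "nat \<Rightarrow> real" and e :: 'a
  assumes e: "e \<in> Basis"
    and G_sub: "G \<subseteq> cbox 0 One" and G_compact: "compact G"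
    and G_pos: "emeasure lborel G > 0" and G_int: "interior G = {}"
    and b_range: "\<And>m. m \<ge> 1 \<Longrightarrow> b m \<in> {0<..<1}"
    and b_lim: "b \<longlonglongrightarrow> 0"
begin

abbreviation "w \<equiv> weightGb e G b"

definition "spike m = (\<lambda>g. (2 * real m) *\<^sub>R e + g) ` G"

text \<open>Reduces every separation argument below to linear arithmetic along \<open>e\<close>:
  distinct slabs, reflected ones included, are at distance at least one when the index is
  positive.\<close>

lemma spike_slab:
  assumes "y \<in> spike m" shows "2 * real m \<le> y \<bullet> e" "y \<bullet> e \<le> 2 * real m + 1"
proof -
  obtain g where g: "g \<in> G" "y = (2 * real m) *\<^sub>R e + g"
    using assms by (auto simp: spike_def)
  have "0 \<le> g \<bullet> e" "g \<bullet> e \<le> 1"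
    using g(1) G_sub e by (auto simp: mem_box subset_eq)
  then show "2 * real m \<le> y \<bullet> e" "y \<bullet> e \<le> 2 * real m + 1"
    using e by (auto simp: g(2) inner_add_left)
qed

lemma compact_spike: "compact (spike m)"
  unfolding spike_def using compact_translation[OF G_compact] by simp

lemma spike_borel [measurable]: "spike m \<in> sets borel"
  by (intro borel_compact compact_spike)

lemma interior_spike: "interior (spike m) = {}"
  unfolding spike_def using interior_translation[of _ G] G_int by simp

lemma emeasure_spike: "emeasure lborel (spike m) = emeasure lborel G"
proof -
  let ?c = "(2 * real m) *\<^sub>R e"
  have "emeasure lborel (spike m) = emeasure (distr lborel borel ((+) ?c)) (spike m)"
    by (simp add: lborel_distr_plus)
  also have "\<dots> = emeasure lborel ((+) ?c -` spike m \<inter> space lborel)"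
    by (rule emeasure_distr) auto
  also have "(+) ?c -` spike m \<inter> space lborel = G"
    by (auto simp: spike_def)
  finally show ?thesis .
qed

lemma emeasure_spike_pos_finite: "0 < emeasure lborel (spike m)" "emeasure lborel (spike m) < \<infinity>"
  using G_pos emeasure_spike emeasure_compact_finite[OF compact_spike, of m] by auto

text \<open>Disjointness of the slabs leaves a single candidate for the \<open>THE\<close> in
  \<open>w_half\<close>.\<close>

lemma w_half_spike:
  assumes "m \<ge> 1" "y \<in> spike m" shows "w_half e G b y = b m"
proof -
  have "(THE m. m \<ge> 1 \<and> y \<in> spike m) = m"
  proof (rule the_equality)
    fix k assume "k \<ge> 1 \<and> y \<in> spike k"
    then show "k = m"
      using spike_slab[of y k] spike_slab[of y m] assms by linarith
  qed (use assms in auto)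
  then show ?thesis
    using assms unfolding w_half_def spike_def by auto
qed

lemma w_half_off_spikes:
  assumes "\<And>m. m \<ge> 1 \<Longrightarrow> y \<notin> spike m" shows "w_half e G b y = 1"
  using assms unfolding w_half_def spike_def by auto

lemma w_spike: "m \<ge> 1 \<Longrightarrow> y \<in> spike m \<Longrightarrow> w y = b m"
  using spike_slab[of y m] by (simp add: weightGb_def w_half_spike)

lemma w_eq_1_off_spikes:
  assumes "\<And>m. m \<ge> 1 \<Longrightarrow> y \<notin> spike m" "\<And>m. m \<ge> 1 \<Longrightarrow> - y \<notin> spike m"
  shows "w y = 1"
  using assms by (simp add: weightGb_def w_half_off_spikes)

lemma w_uminus: "w (- y) = w y"
proof (cases "y \<bullet> e = 0")
  \<comment> \<open>On this hyperplane \<open>weightGb\<close> uses the same branch for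
    \<open>y\<close> and \<open>- y\<close>, so symmetry is not built in; but indices start at 1, no
    spike meets the hyperplane, and both values are 1.\<close>
  case True
  then have "y \<notin> spike m" "- y \<notin> spike m" if "m \<ge> 1" for m
    using spike_slab[of y m] spike_slab[of "- y" m] that by auto
  then show ?thesis
    by (simp add: w_eq_1_off_spikes)
next
  case False
  then show ?thesis
    by (cases "y \<bullet> e > 0") (simp_all add: weightGb_def)
qed

lemma w_le_1: "w y \<le> 1"
proof -
  have "w_half e G b z \<le> 1" for z
  proof (cases "\<exists>m\<ge>1. z \<in> spike m")
    case True
    then show ?thesis using b_range by (auto simp: w_half_spike less_imp_le)
  qed (simp add: w_half_off_spikes)
  then show ?thesis
    by (simp add: weightGb_def)
qed

text \<open>\<open>w_half\<close> takes countably many values, so a preimage is a countable union of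
  spikes, joined with the complement of all spikes if it contains points of value 1.\<close>

lemma w_measurable [measurable]: "w \<in> borel_measurable borel"
proof -
  have half: "w_half e G b \<in> borel_measurable borel"
  proof (rule measurableI)
    fix A :: "real set"
    have "w_half e G b y \<in> A \<longleftrightarrow>
        (\<exists>m. m \<ge> 1 \<and> b m \<in> A \<and> y \<in> spike m) \<or> 1 \<in> A \<and> (\<forall>m. m \<ge> 1 \<longrightarrow> y \<notin> spike m)" for y
    proof (cases "\<exists>m\<ge>1. y \<in> spike m")
      case True
      then obtain m where m: "m \<ge> 1" "y \<in> spike m" by blast
      have "k = m" if "y \<in> spike k" for k
        using spike_slab[of y k] spike_slab[of y m] m that by linarith
      then show ?thesis
        unfolding w_half_spike[OF m] using m by metis
    next
      case False
      then have "w_half e G b y = 1"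
        by (intro w_half_off_spikes) blast
      with False show ?thesis by metis
    qed
    then have "w_half e G b -` A \<inter> space borel = {y \<in> space borel.
        (\<exists>m. m \<ge> 1 \<and> b m \<in> A \<and> y \<in> spike m) \<or> 1 \<in> A \<and> (\<forall>m. m \<ge> 1 \<longrightarrow> y \<notin> spike m)}"
      by (simp add: vimage_def)
    also have "\<dots> \<in> sets borel"
      by measurable
    finally show "w_half e G b -` A \<inter> space borel \<in> sets borel" .
  qed simp
  have "(\<lambda>y. w_half e G b (- y)) \<in> borel_measurable borel"
    by (rule measurable_compose[OF _ half]) simp
  with half show ?thesis
    unfolding weightGb_def by measurable
qed

text \<open>After shrinking \<open>U\<close> to a thin window \<open>W\<close>, all points of
  \<open>W\<close> with weight other than 1 lie in one closed set \<open>H\<close> with empty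
  interior. Then \<open>W\<close> is not inside \<open>H\<close>, and \<open>W - H\<close> is the
  required open set.\<close>

lemma w_eq_1_on_open_subset:
  assumes "open U" "U \<noteq> {}"
  shows "\<exists>V. open V \<and> V \<noteq> {} \<and> V \<subseteq> U \<and> (\<forall>y\<in>V. w y = 1)"
proof -
  obtain y0 where y0: "y0 \<in> U" using assms by blast
  \<comment> \<open>Points of \<open>W\<close> differ by less than 1/2 along \<open>e\<close>, too
    little to reach two different slabs.\<close>
  define W where "W = U \<inter> {y. \<bar>y \<bullet> e - y0 \<bullet> e\<bar> < 1/4}"
  have W: "open W" "y0 \<in> W" "W \<subseteq> U"
    unfolding W_def using y0 \<open>open U\<close>
    by (auto intro!: open_Int open_Collect_less continuous_intros)
  show ?thesis
  proof (cases "\<forall>y\<in>W. w y = 1")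
    case True
    then show ?thesis using W by blast
  next
    case False
    then obtain y m where y: "y \<in> W" "m \<ge> 1" "y \<in> spike m \<or> - y \<in> spike m"
      using w_eq_1_off_spikes by blast
    define H where "H = (if y \<in> spike m then spike m else uminus ` spike m)"
    have H: "closed H" "interior H = {}"
      using compact_imp_closed[OF compact_spike, of m] interior_spike[of m]
      by (auto simp: H_def closed_negations interior_negations)
    have "z \<in> H" if "z \<in> W" "w z \<noteq> 1" for z
    proof -
      obtain k where k: "k \<ge> 1" "z \<in> spike k \<or> - z \<in> spike k"
        using w_eq_1_off_spikes \<open>w z \<noteq> 1\<close> by blast
      have d: "\<bar>z \<bullet> e - y \<bullet> e\<bar> < 1/2"
        using y(1) \<open>z \<in> W\<close> unfolding W_def mem_Collect_eq Int_iff by linarith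
      show ?thesis
      proof (cases "y \<in> spike m")
        case True
        have "- z \<notin> spike k"
          using spike_slab[of "- z" k] spike_slab[OF True] d k(1) y(2) by auto
        then have z: "z \<in> spike k" using k by blast
        then have "k = m"
          using spike_slab[OF z] spike_slab[OF True] d by linarith
        then show ?thesis using z True by (simp add: H_def)
      next
        case False
        then have y': "- y \<in> spike m" using y by blast
        have "z \<notin> spike k"
          using spike_slab[of z k] spike_slab[OF y'] d k(1) y(2) by auto
        then have z: "- z \<in> spike k" using k by blast
        then have "k = m"
          using spike_slab[OF z] spike_slab[OF y'] d unfolding inner_minus_left by linarith
        then show ?thesis using z False by (force simp: H_def image_iff intro: bexI[of _ "- z"])
      qed
    qed
    moreover have "\<not> W \<subseteq> H"
      using interior_maximal[of W H] W H by auto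
    ultimately show ?thesis
      using W H by (intro exI[of _ "W - H"]) (auto intro: open_Diff)
  qed
qed

section \<open>Norm identities and failure of the norm fundamental property\<close>

text \<open>If |u(x)| exceeded an essential bound c of |u| w, then |u| > c on a nonempty open set,
  which contains a smaller one where w = 1. There |u| w > c, contradicting that nonempty open sets
  are not null.\<close>

lemma norm_le_Linf_norm:
  assumes "continuous_on UNIV u"
  shows "ennreal (norm (u x)) \<le> Linf_norm w u"
  unfolding Linf_norm_def
proof (rule Inf_greatest, clarify)
  fix C assume C: "AE x in lborel. ennreal (norm (u x) * w x) \<le> C"
  show "ennreal (norm (u x)) \<le> C"
  proof (cases C)
    case (real c)
    show ?thesis
    proof (rule ccontr)
      assume "\<not> ennreal (norm (u x)) \<le> C"
      then have "x \<in> {y. c < norm (u y)}"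
        using real by simp
      moreover have "open {y. c < norm (u y)}"
        using assms by (intro open_Collect_less continuous_intros)
      ultimately obtain V where V: "open V" "V \<noteq> {}"
          "V \<subseteq> {y. c < norm (u y)}" "\<forall>y\<in>V. w y = 1"
        using w_eq_1_on_open_subset[of "{y. c < norm (u y)}"] by blast
      then have V_less: "c < norm (u y) * w y" if "y \<in> V" for y
        using that by auto
      have "AE y in lborel. y \<notin> V"
        using C V_less real by (auto elim!: eventually_mono simp: not_le[symmetric])
      then show False
        using not_AE_notin_open V by blast
    qed
  qed simp
qed

text \<open>Lebesgue measure and \<open>w\<close> are both invariant under
  \<open>uminus\<close>.\<close>

lemma L1_inv_norm_reflect:
  assumes "f \<in> borel_measurable lborel"
  shows "L1_inv_norm w (\<lambda>x. f (- x)) = L1_inv_norm w f"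
proof -
  have [measurable]: "f \<in> borel_measurable borel" using assms by simp
  have "L1_inv_norm w f = (\<integral>\<^sup>+ x. ennreal (norm (f x) * inverse (w x)) \<partial>distr lborel borel uminus)"
    using lborel_affine[of "-1" "0::'a"] by (simp add: L1_inv_norm_def density_1)
  also have "\<dots> = L1_inv_norm w (\<lambda>x. f (- x))"
    by (subst nn_integral_distr) (auto simp: L1_inv_norm_def w_uminus)
  finally show ?thesis by simp
qed

lemma not_L1_inv_norm_fundamental: "\<not> L1_inv_norm_fundamental w"
proof
  assume fund: "L1_inv_norm_fundamental w"
  \<comment> \<open>One spike is enough: the norm of \<open>f\<close> is \<mu> / b_1, every
    admissible pairing is at most \<mu>, and b_1 < 1.\<close>
  define f :: "'a \<Rightarrow> complex" where "f = indicator (spike 1)"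
  define \<mu> where "\<mu> = measure lborel (spike 1)"
  have mu_eq: "emeasure lborel (spike 1) = ennreal \<mu>"
    using emeasure_spike_pos_finite[of 1] by (simp add: \<mu>_def emeasure_eq_ennreal_measure)
  then have mu_pos: "\<mu> > 0"
    using emeasure_spike_pos_finite[of 1] by simp
  note mu = mu_eq mu_pos
  have b1: "0 < b 1" "b 1 < 1" using b_range[of 1] by auto
  have [measurable]: "f \<in> borel_measurable borel"
    unfolding f_def by measurable
  have "norm (f x) * inverse (w x) = inverse (b 1) * indicator (spike 1) x" for x
    using w_spike[of 1 x] by (simp add: f_def indicator_def)
  then have "L1_inv_norm w f = ennreal (inverse (b 1)) * emeasure lborel (spike 1)"
    using b1 unfolding L1_inv_norm_def
    by (simp add: ennreal_mult' ennreal_indicator nn_integral_cmult_indicator)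
  then have norm_f: "L1_inv_norm w f = ennreal (\<mu> / b 1)"
    using mu b1 by (simp add: ennreal_mult[symmetric] divide_inverse mult.commute)
  then have "in_space (L1_inv_norm w) f"
    by (simp add: in_space_def)
  with fund have "L1_inv_norm w f = Sup {ennreal (norm (integral\<^sup>L lborel (\<lambda>x. f x * \<psi> x))) | \<psi>.
      test_fun \<psi> \<and> Linf_norm w \<psi> \<le> 1}"
    unfolding L1_inv_norm_fundamental_def by blast
  also have "\<dots> \<le> ennreal \<mu>"
  proof (rule Sup_least, clarify)
    fix \<psi> :: "'a \<Rightarrow> complex" assume psi: "test_fun \<psi>" "Linf_norm w \<psi> \<le> 1"
    have cont: "continuous_on UNIV \<psi>"
      using psi(1) smooth_fun_continuous_on unfolding test_fun_def by blast
    have "norm (\<psi> x) \<le> 1" for x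
      using norm_le_Linf_norm[OF cont, of x] psi(2) by (metis ennreal_le_1 order_trans)
    then have "norm (integral\<^sup>L lborel (\<lambda>x. f x * \<psi> x)) \<le> integral\<^sup>L lborel (\<lambda>x. indicator (spike 1) x :: real)"
      using emeasure_spike_pos_finite[of 1]
      by (intro order_trans[OF integral_norm_bound] integral_mono')
         (auto simp: f_def norm_mult split: split_indicator)
    also have "\<dots> = \<mu>" by (simp add: \<mu>_def)
    finally show "ennreal (norm (integral\<^sup>L lborel (\<lambda>x. f x * \<psi> x))) \<le> ennreal \<mu>"
      by (rule ennreal_leI)
  qed
  finally have "\<mu> / b 1 \<le> \<mu>"
    using norm_f mu by simp
  then show False
    using mu b1 by (simp add: field_simps)
qed

section \<open>The Gaussian symbol on the two weighted spaces\<close>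

lemma gaussian_multiplier_Linf:
  "multiplier (Linf_norm w) (\<lambda>\<xi>. complex_of_real (exp (- (norm \<xi>)\<^sup>2 / 2)))"
proof -
  define g where "g = (\<lambda>x::'a. exp (- (norm x)\<^sup>2 / 2))"
  define c where "c = sqrt (2 * pi) ^ DIM('a) / (2 * pi) ^ DIM('a)"
  define I where "I = integral\<^sup>L lborel g"
  have g: "integrable lborel g"
    unfolding g_def by (rule integrable_gaussian)
  then have [measurable]: "g \<in> borel_measurable borel"
    by (simp add: borel_measurable_integrable)
  have c: "c \<ge> 0" by (simp add: c_def)
  \<comment> \<open>As \<open>g\<close> is even, g(x - y) is a pure translate in y, so translation
    invariance alone gives the integral.\<close>
  have g_shift: "integrable lborel (\<lambda>y. g (- x + y))" "(\<integral>y. g (- x + y) \<partial>lborel) = I" for x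
  proof -
    show "integrable lborel (\<lambda>y. g (- x + y))"
      using g integrable_distr_eq[of "(+) (- x)" lborel borel g] by (simp add: lborel_distr_plus)
    show "(\<integral>y. g (- x + y) \<partial>lborel) = I"
      using integral_distr[of "(+) (- x)" lborel borel g] by (simp add: lborel_distr_plus I_def)
  qed
  show ?thesis
    unfolding multiplier_def
  \<comment> \<open>\<open>c * I\<close> is the L^1-norm of the convolution kernel \<open>c\<close>
    times \<open>g\<close>.\<close>
  proof (intro exI[of _ "c * I"] allI impI)
    fix u :: "'a \<Rightarrow> complex"
    assume "schwartz u \<and> in_space (Linf_norm w) u \<and> u \<noteq> (\<lambda>_. 0)"
    then have u: "schwartz u" "in_space (Linf_norm w) u" by auto
    let ?T = "inv_fourier (\<lambda>\<xi>. complex_of_real (exp (- (norm \<xi>)\<^sup>2 / 2)) * fourier u \<xi>)"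
    obtain N where N: "N \<ge> 0" "Linf_norm w u = ennreal N"
      using u(2) unfolding in_space_def by (cases "Linf_norm w u") auto
    have u_le: "norm (u y) \<le> N" for y
      using norm_le_Linf_norm[OF smooth_fun_continuous_on, of u y] u(1)[unfolded schwartz_def] N by simp
    have T_le: "norm (?T x) \<le> c * I * N" for x
    proof -
      have "norm (\<integral>y. u y * complex_of_real (g (x - y)) \<partial>lborel) \<le> (\<integral>y. N * g (- x + y) \<partial>lborel)"
        using g_shift(1)[of x] u_le N
        by (intro order_trans[OF integral_norm_bound] integral_mono')
           (auto simp: g_def norm_mult norm_minus_commute[of x] intro!: mult_right_mono)
      then have "norm (\<integral>y. u y * complex_of_real (g (x - y)) \<partial>lborel) \<le> N * I"
        by (simp only: integral_mult_right_zero g_shift)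
      then have "c * norm (\<integral>y. u y * complex_of_real (g (x - y)) \<partial>lborel) \<le> c * (N * I)"
        using c by (rule mult_left_mono)
      moreover have "?T x = complex_of_real c * (\<integral>y. u y * complex_of_real (g (x - y)) \<partial>lborel)"
        unfolding gaussian_multiplier_conv[OF schwartz_integrable[OF u(1)]] c_def g_def ..
      ultimately show ?thesis
        using c by (simp add: norm_mult mult_ac)
    qed
    \<comment> \<open>The unweighted sup bound returns to the weighted norm because w <= 1.\<close>
    have "norm (?T x) * w x \<le> c * I * N" for x
      using T_le[of x] mult_left_mono[OF w_le_1[of x], of "norm (?T x)"] by simp
    then have "Linf_norm w ?T \<le> ennreal (c * I * N)"
      unfolding Linf_norm_def by (intro Inf_lower) (auto intro: ennreal_leI)
    also have "\<dots> = ennreal (c * I) * Linf_norm w u"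
      using N by (simp add: ennreal_mult'')
    finally show "Linf_norm w ?T \<le> ennreal (c * I) * Linf_norm w u" .
  qed
qed

lemma not_gaussian_multiplier_L1:
  "\<not> multiplier (L1_inv_norm w) (\<lambda>\<xi>. complex_of_real (exp (- (norm \<xi>)\<^sup>2 / 2)))"
proof
  assume "multiplier (L1_inv_norm w) (\<lambda>\<xi>. complex_of_real (exp (- (norm \<xi>)\<^sup>2 / 2)))"
  then obtain C where C: "\<And>u. schwartz u \<Longrightarrow> in_space (L1_inv_norm w) u \<Longrightarrow> u \<noteq> (\<lambda>_. 0) \<Longrightarrow>
      L1_inv_norm w (inv_fourier (\<lambda>\<xi>. complex_of_real (exp (- (norm \<xi>)\<^sup>2 / 2)) * fourier u \<xi>))
        \<le> ennreal C * L1_inv_norm w u"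
    unfolding multiplier_def by blast
  \<comment> \<open>\<open>C\<close> may be negative, and \<open>ennreal\<close> sends negative
    reals to 0; \<open>K\<close> allows a return to real inequalities.\<close>
  define K where "K = max 0 C"
  obtain B where B: "\<And>g. g \<in> G \<Longrightarrow> norm g \<le> B"
    using compact_imp_bounded[OF G_compact] unfolding bounded_iff by blast
  define c where "c = sqrt (2 * pi) ^ DIM('a) / (2 * pi) ^ DIM('a)"
  have c: "c > 0" by (simp add: c_def)
  \<comment> \<open>A lower bound of the Gaussian between a point of \<open>spike m\<close> and a
    point of the bump: the distance is at most B + 1/2 + 1/4, the last two terms being the offset of
    the centre from 2 m e and the radius. It does not depend on m.\<close>
  define \<kappa> where "\<kappa> = exp (- (B + 1)\<^sup>2 / 2)"
  have kappa: "\<kappa> > 0" by (simp add: \<kappa>_def)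
  define \<mu> where "\<mu> = measure lborel G"
  have mu: "emeasure lborel (spike m) = ennreal \<mu>" for m
    using emeasure_compact_finite[OF G_compact] by (simp add: \<mu>_def emeasure_spike emeasure_eq_ennreal_measure)
  then have mu_pos: "\<mu> > 0"
    using emeasure_spike_pos_finite[of 1] by simp
  \<comment> \<open>Multiplier bound for a bump of mass \<open>A\<close> beside
    \<open>spike m\<close>: its image is at least \<open>c * \<kappa> * A\<close> on the spike, so
    its norm is at least that times \<mu> / b_m, against at most \<open>K * A\<close>. The mass
    cancels.\<close>
  have main: "c * \<kappa> * \<mu> \<le> K * b m" if m: "m \<ge> 1" for m
  proof -
    \<comment> \<open>Along \<open>e\<close> the centre is the midpoint of the gap from 2 m - 1 to 2
      m; radius 1/4 keeps the ball strictly inside it.\<close>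
    define p where "p = (2 * real m - 1/2) *\<^sub>R e"
    define h where "h = (\<lambda>x. flat_fun 1 ((1/4)\<^sup>2 - (norm (x - p))\<^sup>2))"
    define u where "u = (\<lambda>x. complex_of_real (h x))"
    define A where "A = integral\<^sup>L lborel h"
    have bm: "0 < b m" using b_range[OF m] by simp
    have h_nonneg: "h x \<ge> 0" for x
      by (simp add: h_def flat_fun_def)
    have h_pos_iff: "h x > 0 \<longleftrightarrow> x \<in> ball p (1/4)" for x
    proof -
      have "h x > 0 \<longleftrightarrow> (norm (x - p))\<^sup>2 < (1/4)\<^sup>2"
        by (simp add: h_def flat_fun_def)
      also have "\<dots> \<longleftrightarrow> norm (x - p) < 1/4"
        using power_mono_iff[of "1/4" "norm (x - p)" 2] by (simp only: not_le[symmetric]) simp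
      finally show ?thesis
        by (simp add: dist_norm norm_minus_commute)
    qed
    have u: "schwartz u"
      unfolding u_def h_def by (rule schwartz_bump)
    have u_int: "integrable lborel u"
      by (rule schwartz_integrable[OF u])
    then have h_int: "integrable lborel h"
      unfolding u_def by (simp add: complex_of_real_integrable_eq)
    then have [measurable]: "h \<in> borel_measurable borel"
      by (simp add: borel_measurable_integrable)
    have "A \<noteq> 0"
    proof
      assume "A = 0"
      then have "AE x in lborel. h x = 0"
        using integral_nonneg_eq_0_iff_AE[OF h_int] h_nonneg by (simp add: A_def)
      then have "AE x in lborel. x \<notin> ball p (1/4)"
        unfolding h_pos_iff[symmetric] by (auto elim: eventually_mono)
      then show False
        using not_AE_notin_open[of "ball p (1/4)"] by simp
    qed
    moreover have "A \<ge> 0"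
      unfolding A_def by (rule integral_nonneg_AE) (simp add: h_nonneg)
    ultimately have A: "A > 0" by simp
    have w_ball: "w y = 1" if "y \<in> ball p (1/4)" for y
    proof (rule w_eq_1_off_spikes)
      have "\<bar>(y - p) \<bullet> e\<bar> < 1/4"
        using Basis_le_norm[OF e, of "y - p"] that by (simp add: dist_norm norm_minus_commute)
      moreover have "p \<bullet> e = 2 * real m - 1/2"
        using e by (simp add: p_def)
      ultimately have y: "2 * real m - 3/4 < y \<bullet> e" "y \<bullet> e < 2 * real m - 1/4"
        unfolding inner_diff_left by linarith+
      \<comment> \<open>Meeting \<open>spike k\<close> would force k < m < k + 1. Reflected spikes
        are excluded by sign, since m >= 1 makes \<open>y \<bullet> e\<close> positive.\<close>
      fix k :: nat assume "k \<ge> 1"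
      show "y \<notin> spike k"
      proof
        assume "y \<in> spike k"
        from spike_slab[OF this] y have "real k < real m" "real m < real (k + 1)"
          by simp_all
        then show False unfolding of_nat_less_iff by simp
      qed
      show "- y \<notin> spike k"
        using spike_slab[of "- y" k] y m by auto
    qed
    have "norm (u x) * inverse (w x) = h x" for x
      using h_nonneg[of x] h_pos_iff[of x] w_ball[of x] by (cases "h x = 0") (auto simp: u_def)
    then have norm_u: "L1_inv_norm w u = ennreal A"
      unfolding L1_inv_norm_def A_def using h_int h_nonneg by (simp add: nn_integral_eq_integral)
    have "in_space (L1_inv_norm w) u"
      using u_int by (simp add: in_space_def norm_u borel_measurable_integrable)
    moreover have "u \<noteq> (\<lambda>_. 0)"
      using h_pos_iff[of p] by (auto simp: u_def fun_eq_iff intro!: exI[of _ p])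
    ultimately have le: "L1_inv_norm w (inv_fourier (\<lambda>\<xi>. complex_of_real (exp (- (norm \<xi>)\<^sup>2 / 2)) * fourier u \<xi>))
        \<le> ennreal C * ennreal A"
      using C[OF u] norm_u by simp
    let ?T = "inv_fourier (\<lambda>\<xi>. complex_of_real (exp (- (norm \<xi>)\<^sup>2 / 2)) * fourier u \<xi>)"
    have T_ge: "c * \<kappa> * A \<le> norm (?T x)" if x: "x \<in> spike m" for x
    proof -
      define k where "k = (\<lambda>y. exp (- (norm (x - y))\<^sup>2 / 2))"
      have k_meas [measurable]: "k \<in> borel_measurable borel"
        unfolding k_def by measurable
      have hk_int: "integrable lborel (\<lambda>y. h y * k y)"
        using h_nonneg by (intro Bochner_Integration.integrable_bound[OF h_int])
          (auto simp: k_def abs_mult intro!: mult_left_le)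
      have "h y * \<kappa> \<le> h y * k y" for y
      proof (cases "y \<in> ball p (1/4)")
        case True
        obtain g where g: "g \<in> G" "x = (2 * real m) *\<^sub>R e + g"
          using x by (auto simp: spike_def)
        have "x - p = g + (1/2) *\<^sub>R e"
          by (simp add: g(2) p_def algebra_simps flip: scaleR_add_left)
        then have "norm (x - p) \<le> B + 1/2"
          using B[OF g(1)] norm_triangle_ineq[of g "(1/2) *\<^sub>R e"] e by simp
        then have "norm (x - y) \<le> B + 1"
          using norm_triangle_ineq[of "x - p" "p - y"] True by (simp add: dist_norm)
        then have "\<kappa> \<le> k y"
          by (simp add: \<kappa>_def k_def power_mono)
        then show ?thesis using h_nonneg by (rule mult_left_mono)
      next
        case False
        then show ?thesis using h_pos_iff[of y] h_nonneg[of y] by simp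
      qed
      then have "(\<integral>y. h y * \<kappa> \<partial>lborel) \<le> (\<integral>y. h y * k y \<partial>lborel)"
        using h_int hk_int by (intro integral_mono) auto
      then have "c * (A * \<kappa>) \<le> c * (\<integral>y. h y * k y \<partial>lborel)"
        using c by (intro mult_left_mono) (auto simp: A_def)
      moreover have "?T x = complex_of_real c * (\<integral>y. complex_of_real (h y * k y) \<partial>lborel)"
        unfolding gaussian_multiplier_conv[OF u_int] c_def k_def by (simp add: u_def)
      then have "?T x = complex_of_real (c * (\<integral>y. h y * k y \<partial>lborel))"
        unfolding integral_complex_of_real by simp
      ultimately show ?thesis
        by (simp add: mult_ac del: of_real_mult)
    qed
    \<comment> \<open>Only the part of the norm of the image carried by \<open>spike m\<close> is
      kept.\<close>
    have "ennreal (c * \<kappa> * A / b m) * emeasure lborel (spike m)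
        = (\<integral>\<^sup>+ x. ennreal (c * \<kappa> * A / b m) * indicator (spike m) x \<partial>lborel)"
      by (simp add: nn_integral_cmult_indicator)
    also have "\<dots> \<le> L1_inv_norm w ?T"
      unfolding L1_inv_norm_def
    proof (intro nn_integral_mono)
      fix x
      show "ennreal (c * \<kappa> * A / b m) * indicator (spike m) x \<le> ennreal (norm (?T x) * inverse (w x))"
      proof (cases "x \<in> spike m")
        case True
        then have "c * \<kappa> * A * inverse (b m) \<le> norm (?T x) * inverse (b m)"
          using T_ge bm by (intro mult_right_mono) auto
        then have "ennreal (c * \<kappa> * A / b m) \<le> ennreal (norm (?T x) * inverse (w x))"
          unfolding w_spike[OF m True] divide_inverse by (rule ennreal_leI)
        then show ?thesis
          using True by (simp only: indicator_simps mult_1_right)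
      qed simp
    qed
    also note le
    also have "ennreal C * ennreal A \<le> ennreal K * ennreal A"
      by (intro mult_right_mono ennreal_leI) (auto simp: K_def)
    finally have "ennreal (c * \<kappa> * A / b m) * ennreal \<mu> \<le> ennreal K * ennreal A"
      unfolding mu .
    then have "ennreal (c * \<kappa> * A / b m * \<mu>) \<le> ennreal (K * A)"
      using c kappa A bm mu_pos by (subst (1 2) ennreal_mult) (auto simp: K_def)
    then have "c * \<kappa> * A / b m * \<mu> \<le> K * A"
      using A by (subst (asm) ennreal_le_iff) (auto simp: K_def)
    then have "A * (c * \<kappa> * \<mu>) \<le> A * (K * b m)"
      using bm by (simp add: field_simps)
    then show ?thesis using A by simp
  qed
  \<comment> \<open>The left side of \<open>main\<close> is a positive constant, so b_m tending to 0
    gives the contradiction.\<close>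
  have "(\<lambda>m. K * b m) \<longlonglongrightarrow> K * 0"
    by (intro tendsto_intros b_lim)
  then have "c * \<kappa> * \<mu> \<le> K * 0"
    using main by (intro LIMSEQ_le_const) auto
  then show False
    using c kappa mu_pos by (simp add: mult_le_0_iff)
qed

end


theorem theorem7p9:
  fixes G :: "'a::euclidean_space set" and b :: "nat \<Rightarrow> real" and e :: 'a
  assumes e: "e \<in> Basis"
    and G_sub: "G \<subseteq> cbox 0 One" and G_compact: "compact G"
    and G_pos: "emeasure lborel G > 0" and G_int: "interior G = {}"
    and b_range: "\<And>m. m \<ge> 1 \<Longrightarrow> b m \<in> {0<..<1}"
    and b_lim: "b \<longlonglongrightarrow> 0"
  shows "(\<forall>f. in_space (L1_inv_norm (weightGb e G b)) f \<longrightarrow>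
            L1_inv_norm (weightGb e G b) f = L1_inv_norm (weightGb e G b) (\<lambda>x. f (- x)))
       \<and> \<not> L1_inv_norm_fundamental (weightGb e G b)
       \<and> (\<exists>a. schwartz a \<and> multiplier (Linf_norm (weightGb e G b)) a
              \<and> \<not> multiplier (L1_inv_norm (weightGb e G b)) a)"
proof -
  interpret spiked_weight G b e
    by standard (use assms in auto)
  have "L1_inv_norm w f = L1_inv_norm w (\<lambda>x. f (- x))" if "in_space (L1_inv_norm w) f" for f
    using that L1_inv_norm_reflect unfolding in_space_def by simp
  then show ?thesis
    using not_L1_inv_norm_fundamental schwartz_gaussian gaussian_multiplier_Linf
      not_gaussian_multiplier_L1 by blast
qed

end
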